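(* Let $T_{12},T_{21}\in \mathcal{B}_{A}(\mathcal{H})$ and $\mathbb{A}=\begin{pmatrix}A&0\\0&A\end{pmatrix}\in \mathcal{B}(\mathcal{H}\oplus \mathcal{H})$. Then $$\frac{1}{2}\|T_{12}+T_{21}\|_A\leq \omega_{\mathbb{A}}\begin{pmatrix}O&T_{12}\\ T_{21}^{\sharp_A}&O\end{pmatrix} \leq \frac{1}{2}\left(\|T_{12}\|_A+\|T_{21}\|_A\right).$$
   Context: $\mathcal{H}$ is a complex Hilbert space with inner product $\langle\cdot\mid\cdot\rangle$ (linear in the first variable), and $A\in\mathcal{B}(\mathcal{H})$ is a nonzero positive (semi-definite) operator. For any positive operator $A$ on a Hilbert space, put $\langle x\mid y\rangle_A=\langle Ax\mid y\rangle$ and $\|x\|_A=\langle x\mid x\rangle_A^{1/2}$. $\mathcal{B}_A(\mathcal{H})$ is the set of $T\in\mathcal{B}(\mathcal{H})$ admitting an $A$-adjoint, i.e. an operator $X\in\mathcal{B}(\mathcal{H})$ with $AX=T^*A$; equivalently $\mathcal{R}(T^*A)\subseteq\mathcal{R}(A)$, where $\mathcal{R}$ denotes range. For $T\in\mathcal{B}_A(\mathcal{H})$, $T^{\sharp_A}$ is the reduced solution of $AX=T^*A$, i.e. the unique solution $X\in\mathcal{B}(\mathcal{H})$ with $\mathcal{R}(X)\subseteq\overline{\mathcal{R}(A)}$; equivalently $T^{\sharp_A}=A^\dagger T^*A$ with $A^\dagger$ the Moore-Penrose inverse of $A$. Every $T\in\mathcal{B}_A(\mathcal{H})$ is $A$-bounded,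 i.e. there is $\lambda>0$ with $\|Tx\|_A\le\lambda\|x\|_A$ for all $x$. For $A$-bounded $T$: $\|T\|_A=\sup\{\|Tx\|_A:\|x\|_A=1\}$ and $\omega_A(T)=\sup\{|\langle Tx\mid x\rangle_A|:\|x\|_A=1\}$. The quantity $\omega_{\mathbb{A}}$ is defined in the same way for the positive operator $\mathbb{A}$ on the Hilbert space $\mathcal{H}\oplus\mathcal{H}$. *)

theory Defs
  imports "HOL-Analysis.Analysis"
begin

section \<open>Complex Hilbert spaces\<close>

text \<open>The inner product is linear in the first variable. The complex scalar multiplication
  extends the real one of \<^class>\<open>real_normed_vector\<close>, and the norm is the one induced by the
  inner product.\<close>

class complex_inner = real_normed_vector +
  fixes scaleC :: "complex \<Rightarrow> 'a \<Rightarrow> 'a"  (infixr "*\<^sub>C" 75)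
    and cinner :: "'a \<Rightarrow> 'a \<Rightarrow> complex"
  assumes scaleC_add_right: "c *\<^sub>C (x + y) = c *\<^sub>C x + c *\<^sub>C y"
    and scaleC_add_left: "(c + d) *\<^sub>C x = c *\<^sub>C x + d *\<^sub>C x"
    and scaleC_scaleC: "c *\<^sub>C (d *\<^sub>C x) = (c * d) *\<^sub>C x"
    and scaleC_of_real: "complex_of_real r *\<^sub>C x = r *\<^sub>R x"
    and cinner_commute: "cinner x y = cnj (cinner y x)"
    and cinner_add_left: "cinner (x + y) z = cinner x z + cinner y z"
    and cinner_scaleC_left: "cinner (c *\<^sub>C x) y = c * cinner x y"
    and cinner_ge_zero: "0 \<le> Re (cinner x x)"
    and cinner_eq_zero_iff: "cinner x x = 0 \<longleftrightarrow> x = 0"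
    and norm_eq_sqrt_cinner: "norm x = sqrt (Re (cinner x x))"

class chilbert_space = complex_inner + complete_space

text \<open>The Hilbert space direct sum; its norm is the existing product norm.\<close>

instantiation prod :: (complex_inner, complex_inner) complex_inner
begin

definition scaleC_prod :: "complex \<Rightarrow> 'a \<times> 'b \<Rightarrow> 'a \<times> 'b" where
  "scaleC_prod c x = (c *\<^sub>C fst x, c *\<^sub>C snd x)"

definition cinner_prod :: "'a \<times> 'b \<Rightarrow> 'a \<times> 'b \<Rightarrow> complex" where
  "cinner_prod x y = cinner (fst x) (fst y) + cinner (snd x) (snd y)"

instance
proof
  fix x y z :: "'a \<times> 'b" and c d :: complex and r :: real
  show "c *\<^sub>C (x + y) = c *\<^sub>C x + c *\<^sub>C y"
    by (simp add: scaleC_prod_def scaleC_add_right)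
  show "(c + d) *\<^sub>C x = c *\<^sub>C x + d *\<^sub>C x"
    by (simp add: scaleC_prod_def scaleC_add_left)
  show "c *\<^sub>C (d *\<^sub>C x) = (c * d) *\<^sub>C x"
    by (simp add: scaleC_prod_def scaleC_scaleC)
  show "complex_of_real r *\<^sub>C x = r *\<^sub>R x"
    by (simp add: scaleC_prod_def scaleC_of_real scaleR_prod_def)
  show "cinner x y = cnj (cinner y x)"
    using cinner_commute[of "fst x" "fst y"] cinner_commute[of "snd x" "snd y"]
    by (simp add: cinner_prod_def)
  show "cinner (x + y) z = cinner x z + cinner y z"
    by (simp add: cinner_prod_def cinner_add_left)
  show "cinner (c *\<^sub>C x) y = c * cinner x y"
    by (simp add: cinner_prod_def scaleC_prod_def cinner_scaleC_left distrib_left)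
  show "0 \<le> Re (cinner x x)"
    by (simp add: cinner_prod_def cinner_ge_zero)
  show norm: "norm x = sqrt (Re (cinner x x))"
    by (simp add: norm_prod_def cinner_prod_def norm_eq_sqrt_cinner cinner_ge_zero)
  show "cinner x x = 0 \<longleftrightarrow> x = 0"
  proof
    assume "cinner x x = 0"
    then have "norm x = 0" using norm by simp
    then show "x = 0" by simp
  next
    assume "x = 0"
    then show "cinner x x = 0"
      using cinner_eq_zero_iff[of "0::'a"] cinner_eq_zero_iff[of "0::'b"]
      by (simp add: cinner_prod_def)
  qed
qed

end

instance prod :: (chilbert_space, chilbert_space) chilbert_space ..


section \<open>Bounded operators\<close>

definition bounded_clinear :: "('a::complex_inner \<Rightarrow> 'b::complex_inner) \<Rightarrow> bool" where
  "bounded_clinear T \<longleftrightarrow> bounded_linear T \<and> (\<forall>c x. T (c *\<^sub>C x) = c *\<^sub>C T x)"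

definition cadjoint :: "('a::chilbert_space \<Rightarrow> 'a) \<Rightarrow> 'a \<Rightarrow> 'a" where
  "cadjoint T = (THE S. bounded_clinear S \<and> (\<forall>x y. cinner (T x) y = cinner x (S y)))"

definition positive_op :: "('a::chilbert_space \<Rightarrow> 'a) \<Rightarrow> bool" where
  "positive_op A \<longleftrightarrow> bounded_clinear A \<and> (\<forall>x. cinner (A x) x \<in> \<real>\<^sub>\<ge>\<^sub>0)"

definition block_op ::
  "('a::chilbert_space \<Rightarrow> 'a) \<Rightarrow> ('a \<Rightarrow> 'a) \<Rightarrow> ('a \<Rightarrow> 'a) \<Rightarrow> ('a \<Rightarrow> 'a) \<Rightarrow> 'a \<times> 'a \<Rightarrow> 'a \<times> 'a" where
  "block_op T11 T12 T21 T22 = (\<lambda>(x, y). (T11 x + T12 y, T21 x + T22 y))"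


section \<open>The semi-inner product induced by a positive operator\<close>

definition inner_A :: "('a::chilbert_space \<Rightarrow> 'a) \<Rightarrow> 'a \<Rightarrow> 'a \<Rightarrow> complex" where
  "inner_A A x y = cinner (A x) y"

definition norm_A :: "('a::chilbert_space \<Rightarrow> 'a) \<Rightarrow> 'a \<Rightarrow> real" where
  "norm_A A x = sqrt (Re (inner_A A x x))"

definition has_A_adjoint :: "('a::chilbert_space \<Rightarrow> 'a) \<Rightarrow> ('a \<Rightarrow> 'a) set" where
  "has_A_adjoint A =
     {T. bounded_clinear T \<and> (\<exists>X. bounded_clinear X \<and> A \<circ> X = cadjoint T \<circ> A)}"

text \<open>The reduced solution of \<open>A X = T\<^sup>* A\<close>.\<close>

definition A_sharp :: "('a::chilbert_space \<Rightarrow> 'a) \<Rightarrow> ('a \<Rightarrow> 'a) \<Rightarrow> 'a \<Rightarrow> 'a" where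
  "A_sharp A T = (THE X. bounded_clinear X \<and> A \<circ> X = cadjoint T \<circ> A \<and>
                         range X \<subseteq> closure (range A))"

text \<open>The suprema below are taken in the reals, hence are meaningful only for \<open>A\<close>-bounded
  \<open>T\<close> and nonzero \<open>A\<close>.\<close>

definition opnorm_A :: "('a::chilbert_space \<Rightarrow> 'a) \<Rightarrow> ('a \<Rightarrow> 'a) \<Rightarrow> real" where
  "opnorm_A A T = (SUP x\<in>{x. norm_A A x = 1}. norm_A A (T x))"

definition numradius_A :: "('a::chilbert_space \<Rightarrow> 'a) \<Rightarrow> ('a \<Rightarrow> 'a) \<Rightarrow> real" where
  "numradius_A A T = (SUP x\<in>{x. norm_A A x = 1}. cmod (inner_A A (T x) x))"

end

theory Submission
  imports Defs
begin

text \<open>Writing \<open>S\<close> for the \<open>A\<close>-adjoint of \<open>T21\<close>, the quadratic form of the off-diagonal block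
  operator at \<open>(x, y)\<close> is \<open>\<langle>T12 y | x\<rangle>\<^sub>A + \<langle>S x | y\<rangle>\<^sub>A = \<langle>T12 y | x\<rangle>\<^sub>A + cnj \<langle>T21 y | x\<rangle>\<^sub>A\<close>. Cauchy-Schwarz and
  \<open>2 \<parallel>x\<parallel>\<^sub>A \<parallel>y\<parallel>\<^sub>A \<le> \<parallel>x\<parallel>\<^sub>A\<^sup>2 + \<parallel>y\<parallel>\<^sub>A\<^sup>2\<close> give the upper bound. For the lower bound take the real part at
  \<open>(w / \<parallel>w\<parallel>\<^sub>A, y) / \<surd>2\<close>, where \<open>\<parallel>y\<parallel>\<^sub>A = 1\<close> and \<open>w = T12 y + T21 y\<close>. The suprema are those of bounded
  sets because \<open>S T21\<close> is selfadjoint for the form and bounded for the norm, which forces it to be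
  bounded for the seminorm.\<close>

section \<open>Identities in complex inner product spaces\<close>

lemma cinner_add_right: "cinner x (y + z) = cinner x y + cinner x z"
  for x :: "'a::complex_inner"
  by (metis cinner_add_left cinner_commute complex_cnj_add)

lemma cinner_scaleC_right: "cinner x (c *\<^sub>C y) = cnj c * cinner x y"
  for x :: "'a::complex_inner"
  by (metis cinner_commute cinner_scaleC_left complex_cnj_mult)

lemma cinner_scaleR_left: "cinner (r *\<^sub>R x) y = of_real r * cinner x y"
  for x :: "'a::complex_inner"
  by (metis cinner_scaleC_left scaleC_of_real)

lemma cinner_scaleR_right: "cinner x (r *\<^sub>R y) = of_real r * cinner x y"
  for x :: "'a::complex_inner"
  by (metis cinner_scaleC_right complex_cnj_complex_of_real scaleC_of_real)

lemma cinner_minus_left: "cinner (- x) y = - cinner x y"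
  for x :: "'a::complex_inner"
  using cinner_scaleR_left[of "-1" x y] by simp

lemma cinner_minus_right: "cinner x (- y) = - cinner x y"
  for x :: "'a::complex_inner"
  using cinner_scaleR_right[of x "-1" y] by simp

lemma cinner_diff_left: "cinner (x - y) z = cinner x z - cinner y z"
  for x :: "'a::complex_inner"
  using cinner_add_left[of x "- y" z] by (simp add: cinner_minus_left)

lemma cinner_diff_right: "cinner x (y - z) = cinner x y - cinner x z"
  for x :: "'a::complex_inner"
  using cinner_add_right[of x y "- z"] by (simp add: cinner_minus_right)

lemma cinner_zero_right [simp]: "cinner y 0 = 0"
  for y :: "'a::complex_inner"
  using cinner_scaleR_right[of y 0 0] by simp

lemmas cinner_simps =
  cinner_add_left cinner_add_right cinner_diff_left cinner_diff_right
  cinner_scaleC_left cinner_scaleC_right cinner_scaleR_left cinner_scaleR_right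

lemma power2_norm_eq_cinner: "(norm x)\<^sup>2 = Re (cinner x x)"
  for x :: "'a::complex_inner"
  by (simp add: norm_eq_sqrt_cinner cinner_ge_zero)

lemma power2_norm_add: "(norm (x + y))\<^sup>2 = (norm x)\<^sup>2 + (norm y)\<^sup>2 + 2 * Re (cinner x y)"
  for x :: "'a::complex_inner"
proof -
  have "Re (cinner y x) = Re (cinner x y)"
    by (subst cinner_commute) simp
  then show ?thesis
    by (simp add: power2_norm_eq_cinner cinner_simps)
qed

lemma parallelogram_law: "(norm (x + y))\<^sup>2 + (norm (x - y))\<^sup>2 = 2 * (norm x)\<^sup>2 + 2 * (norm y)\<^sup>2"
  for x :: "'a::complex_inner"
  using power2_norm_add[of x y] power2_norm_add[of x "- y"] by (simp add: cinner_minus_right)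

lemma norm_scaleC: "norm (c *\<^sub>C x) = cmod c * norm x"
  for x :: "'a::complex_inner"
proof -
  have "(norm (c *\<^sub>C x))\<^sup>2 = Re ((c * cnj c) * cinner x x)"
    by (simp add: power2_norm_eq_cinner cinner_simps mult_ac)
  also have "\<dots> = (cmod c * norm x)\<^sup>2"
    by (simp add: complex_norm_square[symmetric] power_mult_distrib power2_norm_eq_cinner
        del: of_real_power)
  finally show ?thesis by simp
qed

section \<open>Bounded complex-linear maps\<close>

lemma bounded_clinearI:
  fixes T :: "'a::complex_inner \<Rightarrow> 'b::complex_inner"
  assumes add: "\<And>x y. T (x + y) = T x + T y" and scale: "\<And>c x. T (c *\<^sub>C x) = c *\<^sub>C T x"
    and bound: "\<And>x. norm (T x) \<le> K * norm x"
  shows "bounded_clinear T"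
proof -
  have "T (r *\<^sub>R x) = r *\<^sub>R T x" for r x
    using scale[of "complex_of_real r" x] by (simp only: scaleC_of_real)
  then have "bounded_linear T"
    using add bound by (intro bounded_linear_intro[of _ K]) (auto simp: mult.commute)
  then show ?thesis
    using scale by (simp add: bounded_clinear_def)
qed

lemma bounded_clinear_scaleC: "bounded_clinear T \<Longrightarrow> T (c *\<^sub>C x) = c *\<^sub>C T x"
  by (simp add: bounded_clinear_def)

lemma bounded_clinear_add: "bounded_clinear T \<Longrightarrow> T (x + y) = T x + T y"
  by (simp add: bounded_clinear_def linear_simps)

lemma bounded_clinear_diff: "bounded_clinear T \<Longrightarrow> T (x - y) = T x - T y"
  by (simp add: bounded_clinear_def linear_simps)

lemma bounded_clinear_scaleR: "bounded_clinear T \<Longrightarrow> T (r *\<^sub>R x) = r *\<^sub>R T x"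
  by (simp add: bounded_clinear_def linear_simps)

lemma bounded_clinear_zero [simp]: "bounded_clinear T \<Longrightarrow> T 0 = 0"
  using bounded_clinear_scaleR[of T 0 0] by simp

lemma bounded_clinear_bound:
  assumes "bounded_clinear T"
  obtains K where "K > 0" "\<And>x. norm (T x) \<le> K * norm x"
  using assms bounded_linear.pos_bounded[of T]
  by (auto simp: bounded_clinear_def mult.commute)

lemma bounded_clinear_compose:
  assumes "bounded_clinear S" "bounded_clinear T"
  shows "bounded_clinear (\<lambda>x. S (T x))"
  using assms bounded_linear_compose[of S T] by (auto simp: bounded_clinear_def)


section \<open>The semi-inner product of a positive operator\<close>

lemma positive_op_clinear: "positive_op A \<Longrightarrow> bounded_clinear A"
  by (simp add: positive_op_def)

lemma positive_op_cinner:
  assumes "positive_op A"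
  shows "Re (cinner (A x) x) \<ge> 0" "Im (cinner (A x) x) = 0"
  using assms by (auto simp: positive_op_def complex_nonneg_Reals_iff)

text \<open>Polarisation: the form is real on the diagonal, in particular at \<open>x + y\<close> and at
  \<open>x + \<i> y\<close>.\<close>

lemma positive_op_selfadjoint:
  assumes A: "positive_op A"
  shows "cinner (A x) y = cinner x (A y)"
proof -
  note lin = bounded_clinear_add[OF positive_op_clinear[OF A]]
    bounded_clinear_scaleC[OF positive_op_clinear[OF A]]
  have "Im (cinner (A (x + y)) (x + y)) = 0" "Im (cinner (A (x + \<i> *\<^sub>C y)) (x + \<i> *\<^sub>C y)) = 0"
    by (simp_all add: positive_op_cinner[OF A])
  then have "Im (cinner (A x) y) = - Im (cinner (A y) x)" "Re (cinner (A x) y) = Re (cinner (A y) x)"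
    by (simp_all add: lin cinner_simps positive_op_cinner[OF A])
  then have "cinner (A x) y = cnj (cinner (A y) x)"
    by (simp add: complex_eq_iff)
  then show ?thesis
    by (metis cinner_commute)
qed

lemma inner_A_commute:
  assumes "positive_op A"
  shows "inner_A A x y = cnj (inner_A A y x)"
  unfolding inner_A_def using positive_op_selfadjoint[OF assms] by (metis cinner_commute)

lemma inner_A_add_left: "positive_op A \<Longrightarrow> inner_A A (x + y) z = inner_A A x z + inner_A A y z"
  by (simp add: inner_A_def bounded_clinear_add positive_op_clinear cinner_simps)

lemma inner_A_scaleR_left: "positive_op A \<Longrightarrow> inner_A A (r *\<^sub>R x) y = of_real r * inner_A A x y"
  by (simp add: inner_A_def bounded_clinear_scaleR positive_op_clinear cinner_simps)

lemma inner_A_scaleR_right: "inner_A A x (r *\<^sub>R y) = of_real r * inner_A A x y"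
  by (simp add: inner_A_def cinner_simps)

lemma norm_A_ge_zero: "positive_op A \<Longrightarrow> norm_A A x \<ge> 0"
  by (simp add: norm_A_def inner_A_def positive_op_cinner)

lemma power2_norm_A: "positive_op A \<Longrightarrow> (norm_A A x)\<^sup>2 = Re (inner_A A x x)"
  by (simp add: norm_A_def inner_A_def positive_op_cinner)

lemma norm_A_scaleR:
  assumes "positive_op A"
  shows "norm_A A (r *\<^sub>R x) = \<bar>r\<bar> * norm_A A x"
proof -
  have "(norm_A A (r *\<^sub>R x))\<^sup>2 = (\<bar>r\<bar> * norm_A A x)\<^sup>2"
    by (simp add: power2_norm_A[OF assms] inner_A_scaleR_left[OF assms] inner_A_scaleR_right
        power_mult_distrib) (simp add: power2_eq_square)
  then show ?thesis
    using norm_A_ge_zero[OF assms] by (simp add: power2_eq_iff_nonneg)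
qed

text \<open>A real quadratic without sign change has nonpositive discriminant. It serves
  Cauchy-Schwarz for a degenerate form, where \<open>d = 0\<close> may occur, and the first-order
  condition at the minimiser in the Riesz theorem.\<close>

lemma discriminant_nonpos:
  fixes a b d :: real
  assumes q: "\<And>t. 0 \<le> a - 2 * t * b + t\<^sup>2 * d" and "d \<ge> 0"
  shows "b\<^sup>2 \<le> a * d"
proof (cases "d = 0")
  case True
  have "b = 0"
  proof (rule ccontr)
    assume "b \<noteq> 0"
    \<comment> \<open>This \<open>t\<close> turns the affine expression into
      \<open>-1\<close>.\<close>
    then show False
      using q[of "(a + 1) / (2 * b)"] True by (simp add: field_simps)
  qed
  then show ?thesis using True by simp
next
  case False
  then have "d > 0" using \<open>d \<ge> 0\<close> by simp
  \<comment> \<open>\<open>b / d\<close> is the minimiser of the quadratic.\<close>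
  then show ?thesis
    using q[of "b / d"] by (simp add: field_simps power2_eq_square)
qed

text \<open>The form is nonnegative at \<open>x - t z y\<close> with \<open>z = <x | y>_A\<close>
  and real \<open>t\<close>. The factor \<open>z\<close> absorbs the phase, so the linear
  coefficient is \<open>|z|^2\<close> and the real discriminant criterion applies. Definiteness is
  never invoked, so vectors of seminorm zero are covered.\<close>

lemma Cauchy_Schwarz_A:
  assumes A: "positive_op A"
  shows "cmod (inner_A A x y) \<le> norm_A A x * norm_A A y"
proof -
  define z where "z = inner_A A x y"
  note lin = bounded_clinear_diff[OF positive_op_clinear[OF A]]
    bounded_clinear_scaleC[OF positive_op_clinear[OF A]]
  have yx: "cinner (A y) x = cnj z"
    using inner_A_commute[OF A, of y x] by (simp add: z_def inner_A_def)
  have zz: "Re z * Re z + Im z * Im z = (cmod z)\<^sup>2"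
    unfolding cmod_power2 by (simp add: power2_eq_square)
  have "0 \<le> (norm_A A x)\<^sup>2 - 2 * t * (cmod z)\<^sup>2 + t\<^sup>2 * ((cmod z)\<^sup>2 * (norm_A A y)\<^sup>2)" for t :: real
  proof -
    have "0 \<le> Re (cinner (A (x - (of_real t * z) *\<^sub>C y)) (x - (of_real t * z) *\<^sub>C y))"
      by (rule positive_op_cinner[OF A])
    also have "\<dots> = Re (cinner (A x) x) - 2 * t * (Re z * Re z + Im z * Im z)
        + t\<^sup>2 * ((Re z * Re z + Im z * Im z) * Re (cinner (A y) y))"
      using positive_op_cinner(2)[OF A] yx
      by (simp add: lin cinner_simps z_def[unfolded inner_A_def, symmetric] algebra_simps
          power2_eq_square)
    finally show ?thesis
      by (simp only: zz power2_norm_A[OF A] inner_A_def)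
  qed
  then have *: "((cmod z)\<^sup>2)\<^sup>2 \<le> (norm_A A x)\<^sup>2 * ((cmod z)\<^sup>2 * (norm_A A y)\<^sup>2)"
    by (rule discriminant_nonpos) simp
  \<comment> \<open>The discriminant bound carries a surplus factor \<open>|z|^2\<close>, which
    cancels unless \<open>z = 0\<close>.\<close>
  have "(cmod z)\<^sup>2 \<le> (norm_A A x * norm_A A y)\<^sup>2"
  proof (cases "z = 0")
    case False
    then show ?thesis
      using * by (simp add: power2_eq_square mult_ac)
  qed simp
  then show ?thesis
    unfolding z_def by (rule power2_le_imp_le) (simp add: norm_A_ge_zero[OF A])
qed

text \<open>With the identity as \<open>A\<close>, facts about the seminorm specialise to the
  Hilbert norm; this yields the ordinary Cauchy-Schwarz inequality.\<close>

lemma positive_op_id: "positive_op (\<lambda>x. x)"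
  unfolding positive_op_def
proof (intro conjI allI)
  show "bounded_clinear (\<lambda>x::'a. x)"
    by (rule bounded_clinearI[of _ 1]) auto
  show "cinner x x \<in> \<real>\<^sub>\<ge>\<^sub>0" for x :: 'a
    using cinner_ge_zero[of x] cinner_commute[of x x]
    by (auto simp: complex_nonneg_Reals_iff complex_eq_iff)
qed

lemma Cauchy_Schwarz_cinner: "cmod (cinner x y) \<le> norm x * norm y"
  for x :: "'a::chilbert_space"
  using Cauchy_Schwarz_A[OF positive_op_id, of x y]
  by (simp add: inner_A_def norm_A_def norm_eq_sqrt_cinner)

lemma norm_A_le_norm:
  assumes A: "positive_op A"
  obtains C where "C > 0" "\<And>x. norm_A A x \<le> C * norm x"
proof -
  obtain K where K: "K > 0" "\<And>x. norm (A x) \<le> K * norm x"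
    using bounded_clinear_bound[OF positive_op_clinear[OF A]] by metis
  have "norm_A A x \<le> sqrt K * norm x" for x
  proof -
    have "Re (cinner (A x) x) \<le> norm (A x) * norm x"
      using Cauchy_Schwarz_cinner[of "A x" x] complex_Re_le_cmod order_trans by blast
    also have "\<dots> \<le> K * (norm x)\<^sup>2"
      using mult_right_mono[OF K(2), of "norm x" x] by (simp add: power2_eq_square mult_ac)
    finally show ?thesis
      using real_sqrt_le_mono by (fastforce simp: norm_A_def inner_A_def real_sqrt_mult)
  qed
  then show thesis
    using that[of "sqrt K"] K(1) by simp
qed


section \<open>The Riesz representation theorem on closed subspaces\<close>

lemma cinner_eqI:
  fixes x y :: "'a::complex_inner"
  assumes "\<And>z. cinner z x = cinner z y"
  shows "x = y"
  using assms[of "x - y"] cinner_eq_zero_iff[of "x - y"] by (simp add: cinner_diff_right)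

text \<open>The representing vector minimises \<open>\<parallel>y\<parallel>\<^sup>2 - 2 Re (f y)\<close> on \<open>M\<close>; the parallelogram law
  makes minimising sequences Cauchy.\<close>

lemma Riesz_representation_on:
  fixes M :: "'a::chilbert_space set" and f :: "'a \<Rightarrow> complex"
  assumes M: "closed M" "0 \<in> M" "\<And>x y. x \<in> M \<Longrightarrow> y \<in> M \<Longrightarrow> x + y \<in> M"
    "\<And>c x. x \<in> M \<Longrightarrow> c *\<^sub>C x \<in> M"
    and f: "\<And>x y. f (x + y) = f x + f y" "\<And>c x. f (c *\<^sub>C x) = c * f x"
      "\<And>x. cmod (f x) \<le> K * norm x"
  obtains p where "p \<in> M" "\<And>y. y \<in> M \<Longrightarrow> f y = cinner y p"
proof -
  have fR: "f (r *\<^sub>R x) = of_real r * f x" for r x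
    using f(2)[of "complex_of_real r" x] by (simp add: scaleC_of_real)
  have MR: "r *\<^sub>R x \<in> M" if "x \<in> M" for r x
    using M(4)[OF that, of "complex_of_real r"] by (simp add: scaleC_of_real)
  have blf: "bounded_linear f"
    using f fR by (intro bounded_linear_intro[of _ K]) (auto simp: mult.commute scaleR_conv_of_real)
  \<comment> \<open>If \<open>f\<close> is represented on \<open>M\<close> by \<open>p\<close>, then
    \<open>J y = ||y - p||^2 - ||p||^2\<close> there, so \<open>p\<close> is the only possible
    minimiser.\<close>
  define J where "J y = (norm y)\<^sup>2 - 2 * Re (f y)" for y
  define m where "m = (INF y\<in>M. J y)"
  have J_ge: "J y \<ge> - K\<^sup>2" for y
  proof -
    have "0 \<le> (norm y - K)\<^sup>2" by simp
    then have "2 * (K * norm y) \<le> (norm y)\<^sup>2 + K\<^sup>2"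
      by (simp add: power2_diff mult.commute)
    moreover have "Re (f y) \<le> K * norm y"
      using f(3)[of y] complex_Re_le_cmod[of "f y"] by linarith
    ultimately show ?thesis by (simp add: J_def)
  qed
  then have bdd: "bdd_below (J ` M)" by (rule bdd_belowI2)
  have m_le: "m \<le> J y" if "y \<in> M" for y
    unfolding m_def using bdd that by (rule cINF_lower)
  have "\<exists>y\<in>M. J y < m + 1 / real (Suc n)" for n
    unfolding m_def by (rule cINF_less_iff[THEN iffD1]) (use M(2) bdd in auto)
  then obtain s where s: "s n \<in> M" "J (s n) < m + 1 / real (Suc n)" for n
    by metis
  have par: "(norm (x - y))\<^sup>2 \<le> 2 * (J x - m) + 2 * (J y - m)" if "x \<in> M" "y \<in> M" for x y
  proof -
    \<comment> \<open>The midpoint stays in \<open>M\<close>, so it cannot beat the infimum; the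
      parallelogram law turns this into closeness of \<open>x\<close> and \<open>y\<close>.\<close>
    have "J ((1/2) *\<^sub>R (x + y)) \<ge> m"
      using that M(3) MR m_le by blast
    moreover have "4 * J ((1/2) *\<^sub>R (x + y)) = (norm (x + y))\<^sup>2 - 4 * Re (f x) - 4 * Re (f y)"
      unfolding J_def f fR norm_scaleR
      by (simp add: power_mult_distrib power2_eq_square add_divide_distrib)
    ultimately show ?thesis
      using parallelogram_law[of x y] by (simp add: J_def)
  qed
  have "Cauchy s"
  proof (rule metric_CauchyI)
    fix e :: real assume "e > 0"
    define d where "d = e\<^sup>2 / 4"
    have "d > 0" using \<open>e > 0\<close> by (simp add: d_def)
    then obtain N where N: "1 / real (Suc N) < d"
      using nat_approx_posE by blast
    show "\<exists>N. \<forall>i\<ge>N. \<forall>j\<ge>N. dist (s i) (s j) < e"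
    proof (intro exI[of _ N] allI impI)
      fix i j assume ij: "i \<ge> N" "j \<ge> N"
      have small: "J (s k) - m < d" if "k \<ge> N" for k
      proof -
        have "1 / real (Suc k) \<le> 1 / real (Suc N)"
          using that by (simp add: frac_le)
        then show ?thesis using s(2)[of k] N by linarith
      qed
      have "(norm (s i - s j))\<^sup>2 \<le> 2 * (J (s i) - m) + 2 * (J (s j) - m)"
        using par s(1) by blast
      also have "\<dots> < 2 * d + 2 * d"
        using small[OF ij(1)] small[OF ij(2)] by (intro add_strict_mono) simp_all
      also have "\<dots> = e\<^sup>2"
        by (simp add: d_def)
      finally have "(norm (s i - s j))\<^sup>2 < e\<^sup>2" .
      then show "dist (s i) (s j) < e"
        using \<open>e > 0\<close> by (simp add: dist_norm power2_less_imp_less)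
    qed
  qed
  then obtain p where p: "s \<longlonglongrightarrow> p"
    using Cauchy_convergent convergent_def by blast
  have pM: "p \<in> M"
    using closed_sequentially[OF M(1) _ p] s(1) by blast
  have "(\<lambda>n. J (s n)) \<longlonglongrightarrow> J p"
    unfolding J_def by (intro tendsto_intros p bounded_linear.tendsto[OF blf])
  moreover have "(\<lambda>n. m + 1 / real (Suc n)) \<longlonglongrightarrow> m + 0"
    by (intro tendsto_intros LIMSEQ_Suc[OF lim_1_over_n])
  ultimately have "J p \<le> m + 0"
    by (rule LIMSEQ_le) (use s(2) less_imp_le in blast)
  then have Jp: "J p \<le> J y" if "y \<in> M" for y
    using m_le[OF that] by simp
  \<comment> \<open>Along the line \<open>p + t v\<close> the increment of \<open>J\<close> is a
    quadratic in \<open>t\<close> without constant term, so nonnegativity forces its linear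
    coefficient \<open>b\<close> to vanish.\<close>
  have Re_eq: "Re (f v) = Re (cinner v p)" if "v \<in> M" for v
  proof -
    define b where "b = Re (f v) - Re (cinner v p)"
    have pv: "Re (cinner p v) = Re (cinner v p)"
      by (subst cinner_commute) simp
    have "0 \<le> 0 - 2 * t * b + t\<^sup>2 * (norm v)\<^sup>2" for t
    proof -
      have "J p \<le> J (p + t *\<^sub>R v)"
        using Jp M(3) MR pM that by blast
      also have "\<dots> = J p - 2 * t * b + t\<^sup>2 * (norm v)\<^sup>2"
        by (simp add: J_def f fR power2_norm_add cinner_scaleR_right pv b_def power_mult_distrib
            right_diff_distrib)
      finally show ?thesis by simp
    qed
    then have "b\<^sup>2 \<le> 0 * (norm v)\<^sup>2"
      by (rule discriminant_nonpos) simp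
    then show ?thesis by (simp add: b_def)
  qed
  \<comment> \<open>The real part at \<open>\<i> y\<close> supplies the imaginary part at
    \<open>y\<close>, up to sign.\<close>
  have "f y = cinner y p" if "y \<in> M" for y
    using Re_eq[OF that] Re_eq[OF M(4)[OF that, of \<i>]]
    by (simp add: complex_eq_iff f cinner_simps)
  then show thesis using that pM by blast
qed

text \<open>Riesz on the whole space, applied to \<open>x -> <T x | y>\<close> for each
  \<open>y\<close>. Linearity of \<open>S\<close> follows by testing against all vectors, its bound
  by evaluating at \<open>x = S y\<close>.\<close>

lemma cadjoint_exists:
  fixes T :: "'a::chilbert_space \<Rightarrow> 'a"
  assumes T: "bounded_clinear T"
  obtains S where "bounded_clinear S" "\<And>x y. cinner (T x) y = cinner x (S y)"
proof -
  obtain K where K: "K > 0" "\<And>x. norm (T x) \<le> K * norm x"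
    using bounded_clinear_bound[OF T] by metis
  have "\<exists>p. \<forall>x. cinner (T x) y = cinner x p" for y
  proof -
    have "cmod (cinner (T x) y) \<le> (K * norm y) * norm x" for x
      using Cauchy_Schwarz_cinner[of "T x" y] mult_right_mono[OF K(2), of "norm y" x]
      by (simp add: mult_ac)
    then obtain p where "\<And>x. x \<in> UNIV \<Longrightarrow> cinner (T x) y = cinner x p"
      by (rule Riesz_representation_on[of UNIV "\<lambda>x. cinner (T x) y", rotated -2])
        (auto simp: cinner_simps bounded_clinear_add[OF T] bounded_clinear_scaleC[OF T])
    then show ?thesis by auto
  qed
  then obtain S where S: "\<And>x y. cinner (T x) y = cinner x (S y)"
    by metis
  have "bounded_clinear S"
  proof (rule bounded_clinearI)
    show "S (x + y) = S x + S y" for x y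
      by (rule cinner_eqI) (simp add: S[symmetric] cinner_simps)
    show "S (c *\<^sub>C x) = c *\<^sub>C S x" for c x
      by (rule cinner_eqI) (simp add: S[symmetric] cinner_simps)
    show "norm (S y) \<le> K * norm y" for y
    proof (cases "S y = 0")
      case False
      have "norm (S y) * norm (S y) = Re (cinner (T (S y)) y)"
        by (simp add: S power2_norm_eq_cinner[symmetric] power2_eq_square)
      also have "\<dots> \<le> norm (T (S y)) * norm y"
        using Cauchy_Schwarz_cinner[of "T (S y)" y] complex_Re_le_cmod order_trans by blast
      also have "\<dots> \<le> norm (S y) * (K * norm y)"
        using mult_right_mono[OF K(2), of "norm y" "S y"] by (simp add: mult_ac)
      finally show ?thesis using False by simp
    qed (use K(1) in simp)
  qed
  then show thesis using that S by blast
qed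

text \<open>The definite description in \<open>cadjoint\<close> denotes an adjoint only once
  uniqueness is known; uniqueness holds because vectors with equal inner products against everything
  agree.\<close>

lemma cadjoint_cinner:
  fixes T :: "'a::chilbert_space \<Rightarrow> 'a"
  assumes T: "bounded_clinear T"
  shows "cinner (T x) y = cinner x (cadjoint T y)"
proof -
  have "\<exists>!S. bounded_clinear S \<and> (\<forall>x y. cinner (T x) y = cinner x (S y))"
  proof (rule ex_ex1I)
    show "\<exists>S. bounded_clinear S \<and> (\<forall>x y. cinner (T x) y = cinner x (S y))"
      using cadjoint_exists[OF T] by metis
    show "S = S'" if "bounded_clinear S \<and> (\<forall>x y. cinner (T x) y = cinner x (S y))"
      "bounded_clinear S' \<and> (\<forall>x y. cinner (T x) y = cinner x (S' y))" for S S'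
    proof
      show "S y = S' y" for y
        by (rule cinner_eqI) (metis that)
    qed
  qed
  from theI'[OF this] show ?thesis
    unfolding cadjoint_def by blast
qed


section \<open>The reduced solution\<close>

text \<open>Limits of sums and multiples of elements of the range; these are the subspace conditions
  for applying Riesz to the closure.\<close>

lemma closure_range_clinear:
  fixes A :: "'a::complex_inner \<Rightarrow> 'b::complex_inner"
  assumes A: "bounded_clinear A"
  shows "0 \<in> closure (range A)"
    and "x \<in> closure (range A) \<Longrightarrow> y \<in> closure (range A) \<Longrightarrow> x + y \<in> closure (range A)"
    and "x \<in> closure (range A) \<Longrightarrow> c *\<^sub>C x \<in> closure (range A)"
proof -
  show "0 \<in> closure (range A)"
    using closure_subset[of "range A"] rangeI[of A 0] by (auto simp: bounded_clinear_zero[OF A])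
next
  assume "x \<in> closure (range A)" "y \<in> closure (range A)"
  then obtain u v where u: "\<And>n. u n \<in> range A" "u \<longlonglongrightarrow> x" and v: "\<And>n. v n \<in> range A" "v \<longlonglongrightarrow> y"
    unfolding closure_sequential by blast
  have "u n + v n \<in> range A" for n
  proof -
    obtain a b where "u n = A a" "v n = A b"
      using u(1)[of n] v(1)[of n] by blast
    then have "u n + v n = A (a + b)"
      by (simp add: bounded_clinear_add[OF A])
    then show ?thesis by simp
  qed
  then show "x + y \<in> closure (range A)"
    unfolding closure_sequential using tendsto_add[OF u(2) v(2)]
    by (intro exI[of _ "\<lambda>n. u n + v n"]) auto
next
  assume "x \<in> closure (range A)"
  then obtain u where u: "\<And>n. u n \<in> range A" "u \<longlonglongrightarrow> x"
    unfolding closure_sequential by blast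
  have "bounded_clinear (\<lambda>x::'b. c *\<^sub>C x)"
    by (rule bounded_clinearI[of _ "cmod c"])
      (simp_all add: scaleC_add_right scaleC_scaleC norm_scaleC mult.commute)
  then have "(\<lambda>n. c *\<^sub>C u n) \<longlonglongrightarrow> c *\<^sub>C x"
    using u(2) by (simp add: bounded_clinear_def bounded_linear.tendsto)
  moreover have "c *\<^sub>C u n \<in> range A" for n
  proof -
    obtain a where "u n = A a"
      using u(1)[of n] by blast
    then have "c *\<^sub>C u n = A (c *\<^sub>C a)"
      by (simp add: bounded_clinear_scaleC[OF A])
    then show ?thesis by simp
  qed
  ultimately show "c *\<^sub>C x \<in> closure (range A)"
    unfolding closure_sequential by (intro exI[of _ "\<lambda>n. c *\<^sub>C u n"]) auto
qed

text \<open>On the range, \<open><A a | z> = <a | A z> = 0\<close>; continuity extends this to the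
  closure. It gives uniqueness of the reduced solution.\<close>

lemma ker_orthogonal_closure_range:
  fixes A :: "'a::chilbert_space \<Rightarrow> 'a"
  assumes A: "positive_op A" and "A z = 0" and "y \<in> closure (range A)"
  shows "cinner y z = 0"
proof -
  obtain u where u: "\<And>n. u n \<in> range A" "u \<longlonglongrightarrow> y"
    using \<open>y \<in> closure (range A)\<close> unfolding closure_sequential by blast
  have "bounded_linear (\<lambda>y. cinner y z)"
    using Cauchy_Schwarz_cinner[of _ z]
    by (intro bounded_linear_intro[of _ "norm z"]) (auto simp: cinner_simps scaleR_conv_of_real)
  then have "(\<lambda>n. cinner (u n) z) \<longlonglongrightarrow> cinner y z"
    using u(2) by (rule bounded_linear.tendsto)
  moreover have "cinner (u n) z = 0" for n
    using u(1)[of n] positive_op_selfadjoint[OF A, of _ z] \<open>A z = 0\<close> by auto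
  ultimately show ?thesis
    by (simp add: LIMSEQ_const_iff)
qed

text \<open>The orthogonal projection onto the closure of the range, whose kernel is that of \<open>A\<close>.\<close>

lemma range_projection:
  fixes A :: "'a::chilbert_space \<Rightarrow> 'a"
  assumes A: "positive_op A"
  obtains P where "bounded_clinear P" "\<And>x. P x \<in> closure (range A)" "\<And>x. A (P x) = A x"
proof -
  let ?M = "closure (range A)"
  note M = closure_range_clinear[OF positive_op_clinear[OF A]]
  have "\<exists>p. p \<in> ?M \<and> (\<forall>y\<in>?M. cinner y x = cinner y p)" for x
  proof -
    have "cmod (cinner y x) \<le> norm x * norm y" for y
      using Cauchy_Schwarz_cinner[of y x] by (simp add: mult.commute)
    then obtain p where "p \<in> ?M" "\<And>y. y \<in> ?M \<Longrightarrow> cinner y x = cinner y p"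
      by (rule Riesz_representation_on[of ?M "\<lambda>y. cinner y x", rotated -2])
        (auto simp: cinner_simps M)
    then show ?thesis by auto
  qed
  then obtain P where P: "\<And>x. P x \<in> ?M" "\<And>x y. y \<in> ?M \<Longrightarrow> cinner y x = cinner y (P x)"
    by metis
  \<comment> \<open>The difference of \<open>p\<close> and \<open>q\<close> lies in the subspace,
    hence is orthogonal to itself.\<close>
  have eqI: "p = q" if "p \<in> ?M" "q \<in> ?M" "\<And>y. y \<in> ?M \<Longrightarrow> cinner y p = cinner y q" for p q
  proof -
    have "p + (-1) *\<^sub>C q \<in> ?M"
      using that M by blast
    moreover have "p + (-1) *\<^sub>C q = p - q"
      using scaleC_of_real[of "-1" q] by simp
    ultimately have "cinner (p - q) (p - q) = 0"
      using that(3)[of "p - q"] by (simp add: cinner_diff_right)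
    then show ?thesis by (simp add: cinner_eq_zero_iff)
  qed
  have "bounded_clinear P"
  proof (rule bounded_clinearI)
    show "P (x + y) = P x + P y" for x y
      by (rule eqI) (auto simp: P(1) P(2)[symmetric] M cinner_add_right)
    show "P (c *\<^sub>C x) = c *\<^sub>C P x" for c x
      by (rule eqI) (auto simp: P(1) P(2)[symmetric] M cinner_scaleC_right)
    show "norm (P x) \<le> 1 * norm x" for x
    proof (cases "P x = 0")
      case False
      have "norm (P x) * norm (P x) = Re (cinner (P x) x)"
        using P(2)[OF P(1)[of x], of x]
        by (simp add: power2_norm_eq_cinner[symmetric] power2_eq_square)
      also have "\<dots> \<le> norm (P x) * norm x"
        using Cauchy_Schwarz_cinner[of "P x" x] complex_Re_le_cmod order_trans by blast
      finally show ?thesis using False by simp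
    qed simp
  qed
  moreover have "A (P x) = A x" for x
  proof (rule cinner_eqI)
    fix z
    have "A z \<in> ?M"
      using closure_subset[of "range A"] by auto
    then show "cinner z (A (P x)) = cinner z (A x)"
      using P(2)[of "A z" x] by (simp add: positive_op_selfadjoint[OF A])
  qed
  ultimately show thesis using that P(1) by blast
qed

text \<open>Projecting any solution onto the closure of the range keeps \<open>A X\<close> unchanged
  and makes it reduced. Two reduced solutions differ by vectors lying both in the kernel of
  \<open>A\<close> and in the closure of its range, which are orthogonal.\<close>

lemma A_sharp_solution:
  fixes A T :: "'a::chilbert_space \<Rightarrow> 'a"
  assumes A: "positive_op A" and T: "T \<in> has_A_adjoint A"
  shows "bounded_clinear (A_sharp A T)" and "A (A_sharp A T x) = cadjoint T (A x)"
proof -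
  let ?sol = "\<lambda>X. bounded_clinear X \<and> A \<circ> X = cadjoint T \<circ> A \<and> range X \<subseteq> closure (range A)"
  obtain X where X: "bounded_clinear X" "A \<circ> X = cadjoint T \<circ> A"
    using T by (auto simp: has_A_adjoint_def)
  obtain P where P: "bounded_clinear P" "\<And>x. P x \<in> closure (range A)" "\<And>x. A (P x) = A x"
    using range_projection[OF A] by metis
  have "\<exists>!X. ?sol X"
  proof (rule ex_ex1I)
    show "\<exists>X. ?sol X"
      using bounded_clinear_compose[OF P(1) X(1)] X(2) P(2,3)
      by (intro exI[of _ "\<lambda>x. P (X x)"]) (auto simp: fun_eq_iff)
    show "Y = Z" if Y: "?sol Y" and Z: "?sol Z" for Y Z
    proof
      fix x
      have ker: "A (Y x - Z x) = 0"
        using Y Z by (simp add: bounded_clinear_diff[OF positive_op_clinear[OF A]] fun_eq_iff)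
      have "Y x \<in> closure (range A)" "Z x \<in> closure (range A)"
        using Y Z by auto
      then have "cinner (Y x - Z x) (Y x - Z x) = 0"
        using ker_orthogonal_closure_range[OF A ker] by (simp add: cinner_diff_left)
      then show "Y x = Z x"
        by (simp add: cinner_eq_zero_iff)
    qed
  qed
  from theI'[OF this] have "?sol (A_sharp A T)"
    unfolding A_sharp_def .
  then show "bounded_clinear (A_sharp A T)" "A (A_sharp A T x) = cadjoint T (A x)"
    by (auto simp: fun_eq_iff)
qed

lemma inner_A_sharp:
  assumes A: "positive_op A" and T: "T \<in> has_A_adjoint A"
  shows "inner_A A (T x) y = inner_A A x (A_sharp A T y)"
proof -
  have "bounded_clinear T" using T by (simp add: has_A_adjoint_def)
  then have "cinner (T x) (A y) = cinner x (A (A_sharp A T y))"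
    using cadjoint_cinner A_sharp_solution(2)[OF A T] by metis
  then show ?thesis
    by (simp add: inner_A_def positive_op_selfadjoint[OF A])
qed


section \<open>Boundedness for the seminorm\<close>

text \<open>If \<open>a / K > 1\<close>, its powers would exceed every constant
  \<open>C\<close>.\<close>

lemma le_of_power_le:
  fixes a K C :: real
  assumes "K > 0" and le: "\<And>n. a ^ n \<le> C * K ^ n"
  shows "a \<le> K"
proof (rule ccontr)
  assume "\<not> a \<le> K"
  then have "1 < a / K" using \<open>K > 0\<close> by simp
  then obtain n where "C < (a / K) ^ n"
    using real_arch_pow by blast
  then show False
    using le[of n] \<open>K > 0\<close> by (simp add: power_divide field_simps)
qed

text \<open>The numbers \<open>\<parallel>S\<^sup>n x\<parallel>\<^sub>A\<close> are log-convex in \<open>n\<close> and grow at most like \<open>K\<^sup>n\<close>.\<close>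

lemma A_selfadjoint_bound:
  assumes A: "positive_op A" and sa: "\<And>x y. inner_A A (S x) y = inner_A A x (S y)"
    and K: "K > 0" "\<And>x. norm (S x) \<le> K * norm x"
  shows "norm_A A (S x) \<le> K * norm_A A x"
proof -
  note nn = norm_A_ge_zero[OF A]
  have step: "(norm_A A (S y))\<^sup>2 \<le> norm_A A y * norm_A A (S (S y))" for y
  proof -
    have "(norm_A A (S y))\<^sup>2 \<le> cmod (inner_A A y (S (S y)))"
      by (simp add: power2_norm_A[OF A] sa complex_Re_le_cmod)
    then show ?thesis
      using Cauchy_Schwarz_A[OF A] order_trans by blast
  qed
  show ?thesis
  proof (cases "norm_A A x = 0")
    case True
    \<comment> \<open>Log-convexity at \<open>x\<close> already gives \<open>||S x||_A = 0\<close>,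
      so a null vector stays null.\<close>
    then show ?thesis using step[of x] by simp
  next
    case False
    then have pos: "norm_A A x > 0" using nn[of x] by simp
    define a where "a n = norm_A A ((S ^^ n) x)" for n
    define q where "q = norm_A A (S x) / norm_A A x"
    have q0: "q \<ge> 0" by (simp add: q_def nn)
    have conv: "(a (Suc n))\<^sup>2 \<le> a n * a (Suc (Suc n))" for n
      using step[of "(S ^^ n) x"] by (simp add: a_def)
    have a0: "a n \<ge> 0" for n by (simp add: a_def nn)
    \<comment> \<open>Log-convexity makes successive ratios nondecreasing, so each is at least the
      first one, \<open>q\<close>; the product form avoids dividing by a vanishing
      \<open>a n\<close>.\<close>
    have ratio: "q * a n \<le> a (Suc n)" for n
    proof (induction n)
      case 0
      then show ?case using pos by (simp add: a_def q_def)
    next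
      case (Suc n)
      show ?case
      proof (cases "a (Suc n) = 0")
        case False
        then have "a (Suc n) > 0" using a0[of "Suc n"] by simp
        have "q * a (Suc n) * a (Suc n) \<le> q * (a n * a (Suc (Suc n)))"
          using mult_left_mono[OF conv[of n] q0] by (simp add: power2_eq_square mult_ac)
        also have "\<dots> \<le> a (Suc (Suc n)) * a (Suc n)"
          using mult_right_mono[OF Suc.IH a0[of "Suc (Suc n)"]] by (simp add: mult_ac)
        finally show ?thesis
          using \<open>a (Suc n) > 0\<close> by simp
      qed (use a0 in simp)
    qed
    have lower: "q ^ n * norm_A A x \<le> a n" for n
    proof (induction n)
      case (Suc n)
      have "q * (q ^ n * norm_A A x) \<le> q * a n"
        using Suc.IH q0 by (rule mult_left_mono)
      with ratio[of n] show ?case by (simp add: mult_ac)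
    qed (simp add: a_def)
    have upper: "norm ((S ^^ n) x) \<le> K ^ n * norm x" for n
    proof (induction n)
      case (Suc n)
      have "norm (S ((S ^^ n) x)) \<le> K * norm ((S ^^ n) x)" by (rule K(2))
      also have "\<dots> \<le> K * (K ^ n * norm x)"
        using Suc.IH K(1) by (intro mult_left_mono) auto
      finally show ?case by (simp add: mult_ac)
    qed simp
    obtain C where C: "C > 0" "\<And>y. norm_A A y \<le> C * norm y"
      using norm_A_le_norm[OF A] by metis
    have "q ^ n \<le> (C * norm x / norm_A A x) * K ^ n" for n
    proof -
      have "q ^ n * norm_A A x \<le> C * norm ((S ^^ n) x)"
        using lower[of n] C(2)[of "(S ^^ n) x"] by (simp add: a_def)
      also have "\<dots> \<le> C * (K ^ n * norm x)"
        using upper[of n] C(1) by simp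
      finally show ?thesis using pos by (simp add: field_simps)
    qed
    then have "q \<le> K"
      by (rule le_of_power_le[OF K(1)])
    then show ?thesis using pos by (simp add: q_def field_simps)
  qed
qed

text \<open>\<open>||T x||_A^2 = <x | S x>_A\<close> with \<open>S = A_sharp A T\<close> after
  \<open>T\<close>, which is selfadjoint for the form; Cauchy-Schwarz and the seminorm bound for
  \<open>S\<close> finish.\<close>

lemma A_bounded:
  assumes A: "positive_op A" and T: "T \<in> has_A_adjoint A"
  obtains K where "\<And>x. norm_A A (T x) \<le> K * norm_A A x"
proof -
  let ?S = "\<lambda>x. A_sharp A T (T x)"
  have sa: "inner_A A (?S x) y = inner_A A x (?S y)" for x y
    using inner_A_sharp[OF A T] inner_A_commute[OF A] by metis
  have "bounded_clinear ?S"
    using A_sharp_solution(1)[OF A T] T by (simp add: bounded_clinear_compose has_A_adjoint_def)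
  then obtain K where K: "K > 0" "\<And>x. norm (?S x) \<le> K * norm x"
    using bounded_clinear_bound by metis
  have "norm_A A (T x) \<le> sqrt K * norm_A A x" for x
  proof -
    have "(norm_A A (T x))\<^sup>2 \<le> cmod (inner_A A x (?S x))"
      by (simp add: power2_norm_A[OF A] inner_A_sharp[OF A T] complex_Re_le_cmod)
    also have "\<dots> \<le> norm_A A x * norm_A A (?S x)"
      by (rule Cauchy_Schwarz_A[OF A])
    also have "\<dots> \<le> norm_A A x * (K * norm_A A x)"
      using A_selfadjoint_bound[OF A sa K] norm_A_ge_zero[OF A] by (rule mult_left_mono)
    also have "\<dots> = (sqrt K * norm_A A x)\<^sup>2"
      using K(1) by (simp add: power_mult_distrib) (simp add: power2_eq_square)
    finally show ?thesis
      by (rule power2_le_imp_le) (use K(1) norm_A_ge_zero[OF A] in simp)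
  qed
  then show thesis using that by blast
qed

lemma norm_A_le_opnorm_A:
  assumes A: "positive_op A" and T: "T \<in> has_A_adjoint A"
  shows "norm_A A (T x) \<le> opnorm_A A T * norm_A A x"
proof -
  obtain K where K: "\<And>x. norm_A A (T x) \<le> K * norm_A A x"
    using A_bounded[OF A T] by metis
  show ?thesis
  \<comment> \<open>The supremum only sees vectors of seminorm one; null vectors are handled by the
    bound \<open>K\<close>, which sends them to null vectors.\<close>
  proof (cases "norm_A A x = 0")
    case True
    then show ?thesis using K[of x] by simp
  next
    case False
    then have pos: "norm_A A x > 0" using norm_A_ge_zero[OF A, of x] by simp
    let ?u = "(1 / norm_A A x) *\<^sub>R x"
    have "norm_A A ?u = 1"
      using pos by (simp add: norm_A_scaleR[OF A])
    moreover have "bdd_above ((\<lambda>x. norm_A A (T x)) ` {x. norm_A A x = 1})"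
    proof (rule bdd_aboveI2)
      show "norm_A A (T y) \<le> K" if "y \<in> {x. norm_A A x = 1}" for y
        using K[of y] that by simp
    qed
    ultimately have "norm_A A (T ?u) \<le> opnorm_A A T"
      unfolding opnorm_A_def by (intro cSUP_upper) auto
    moreover have "norm_A A (T ?u) = norm_A A (T x) / norm_A A x"
      using T pos by (simp add: has_A_adjoint_def bounded_clinear_scaleR norm_A_scaleR[OF A])
    ultimately show ?thesis using pos by (simp add: field_simps)
  qed
qed

text \<open>If \<open>A x\<close> is nonzero, then \<open><x | A x>_A = ||A x||^2\<close> is
  nonzero, and Cauchy-Schwarz excludes \<open>||x||_A = 0\<close>. This keeps the index sets of the
  suprema nonempty.\<close>

lemma exists_norm_A_one:
  assumes A: "positive_op A" and "A \<noteq> (\<lambda>_. 0)"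
  obtains x where "norm_A A x = 1"
proof -
  obtain x where x: "A x \<noteq> 0" using \<open>A \<noteq> (\<lambda>_. 0)\<close> by auto
  then have "inner_A A x (A x) \<noteq> 0"
    by (simp add: inner_A_def cinner_eq_zero_iff)
  then have "norm_A A x \<noteq> 0"
    using Cauchy_Schwarz_A[OF A, of x "A x"] by auto
  then have "norm_A A ((1 / norm_A A x) *\<^sub>R x) = 1"
    using norm_A_ge_zero[OF A, of x] by (simp add: norm_A_scaleR[OF A])
  then show thesis using that by blast
qed


section \<open>Block operators\<close>

lemma power2_norm_A_block_diag:
  assumes "positive_op A"
  shows "(norm_A (block_op A (\<lambda>_. 0) (\<lambda>_. 0) A) (x, y))\<^sup>2 = (norm_A A x)\<^sup>2 + (norm_A A y)\<^sup>2"
  unfolding norm_A_def inner_A_def block_op_def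
  using positive_op_cinner(1)[OF assms] by (simp add: cinner_prod_def)

lemma inner_A_block_off_diag:
  assumes A: "positive_op A" and T: "T \<in> has_A_adjoint A"
  shows "inner_A (block_op A (\<lambda>_. 0) (\<lambda>_. 0) A)
           (block_op (\<lambda>_. 0) S (A_sharp A T) (\<lambda>_. 0) (x, y)) (x, y)
         = inner_A A (S y) x + cnj (inner_A A (T y) x)"
proof -
  have "inner_A A (A_sharp A T x) y = cnj (inner_A A (T y) x)"
    using inner_A_sharp[OF A T] inner_A_commute[OF A] by metis
  then show ?thesis
    by (simp add: inner_A_def block_op_def cinner_prod_def)
qed

theorem theorem3p4:
  fixes A T12 T21 :: "'a::chilbert_space \<Rightarrow> 'a"
  assumes "positive_op A"
    and "A \<noteq> (\<lambda>_. 0)"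
    and "T12 \<in> has_A_adjoint A"
    and "T21 \<in> has_A_adjoint A"
  shows "1 / 2 * opnorm_A A (\<lambda>x. T12 x + T21 x)
           \<le> numradius_A (block_op A (\<lambda>_. 0) (\<lambda>_. 0) A)
               (block_op (\<lambda>_. 0) T12 (A_sharp A T21) (\<lambda>_. 0))
       \<and> numradius_A (block_op A (\<lambda>_. 0) (\<lambda>_. 0) A)
               (block_op (\<lambda>_. 0) T12 (A_sharp A T21) (\<lambda>_. 0))
           \<le> 1 / 2 * (opnorm_A A T12 + opnorm_A A T21)"
proof -
  note A = \<open>positive_op A\<close> and T12 = \<open>T12 \<in> has_A_adjoint A\<close> and T21 = \<open>T21 \<in> has_A_adjoint A\<close>
  note nn = norm_A_ge_zero[OF A]
  define D where "D = block_op A (\<lambda>_. 0) (\<lambda>_. 0) A"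
  define B where "B = block_op (\<lambda>_. 0) T12 (A_sharp A T21) (\<lambda>_. 0)"
  define c where "c = 1 / 2 * (opnorm_A A T12 + opnorm_A A T21)"
  note form = inner_A_block_off_diag[OF A T21, of T12, folded D_def B_def]
  note norm_D = power2_norm_A_block_diag[OF A, folded D_def]
  have D_eq_1: "norm_A D (x, y) = 1 \<longleftrightarrow> (norm_A A x)\<^sup>2 + (norm_A A y)\<^sup>2 = 1" for x y
  proof -
    have "norm_A D (x, y) \<ge> 0"
      using positive_op_cinner(1)[OF A]
      by (simp add: D_def norm_A_def inner_A_def block_op_def cinner_prod_def)
    then show ?thesis
      by (metis norm_D one_power2 power2_eq_iff_nonneg zero_le_one)
  qed
  obtain e where e: "norm_A A e = 1"
    using exists_norm_A_one[OF A assms(2)] by metis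
  have "norm_A A 0 = 0"
    using norm_A_scaleR[OF A, of 0 0] by simp
  then have e0: "norm_A D (e, 0) = 1"
    by (simp add: D_eq_1 e)
  \<comment> \<open>This pointwise bound gives the upper estimate and also the boundedness that lets
    single values be compared with the supremum.\<close>
  have c_ge: "cmod (inner_A D (B z) z) \<le> c" if "norm_A D z = 1" for z
  proof (cases z)
    case (Pair x y)
    have one: "(norm_A A x)\<^sup>2 + (norm_A A y)\<^sup>2 = 1"
      using that Pair D_eq_1 by simp
    have T_le: "cmod (inner_A A (T y) x) \<le> opnorm_A A T * (norm_A A x * norm_A A y)"
      if "T \<in> has_A_adjoint A" for T
      using Cauchy_Schwarz_A[OF A, of "T y" x]
        mult_right_mono[OF norm_A_le_opnorm_A[OF A that, of y] nn[of x]]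
      by (simp add: mult_ac)
    have op_nonneg: "opnorm_A A T \<ge> 0" if "T \<in> has_A_adjoint A" for T
      using norm_A_le_opnorm_A[OF A that, of e] nn[of "T e"] e by simp
    have "0 \<le> (norm_A A x - norm_A A y)\<^sup>2" by simp
    then have xy: "norm_A A x * norm_A A y \<le> 1 / 2"
      using one by (simp add: power2_diff)
    have "cmod (inner_A D (B z) z) \<le> cmod (inner_A A (T12 y) x) + cmod (inner_A A (T21 y) x)"
      unfolding Pair form
      using norm_triangle_ineq[of "inner_A A (T12 y) x" "cnj (inner_A A (T21 y) x)"] by simp
    also have "\<dots> \<le> (opnorm_A A T12 + opnorm_A A T21) * (norm_A A x * norm_A A y)"
      using T_le[OF T12] T_le[OF T21] by (simp add: distrib_right)
    also have "\<dots> \<le> c"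
      using mult_left_mono[OF xy, of "opnorm_A A T12 + opnorm_A A T21"]
        op_nonneg[OF T12] op_nonneg[OF T21] by (simp add: c_def)
    finally show ?thesis .
  qed
  have upper: "numradius_A D B \<le> c"
    unfolding numradius_A_def using e0 c_ge by (intro cSUP_least) auto
  have numradius_ge: "cmod (inner_A D (B z) z) \<le> numradius_A D B" if "norm_A D z = 1" for z
    unfolding numradius_A_def using that c_ge
    by (intro cSUP_upper bdd_aboveI2[of _ _ c]) auto
  have lower: "norm_A A (T12 y + T21 y) \<le> 2 * numradius_A D B" if y: "norm_A A y = 1" for y
  proof (cases "norm_A A (T12 y + T21 y) = 0")
    \<comment> \<open>Here \<open>w\<close> cannot be normalised, but the numerical radius is
      nonnegative.\<close>
    case True
    then show ?thesis
      using numradius_ge[OF e0] norm_ge_zero[of "inner_A D (B (e, 0)) (e, 0)"] by linarith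
  next
    case False
    define w where "w = T12 y + T21 y"
    define s where "s = norm_A A w"
    \<comment> \<open>With this factor each component has squared seminorm \<open>1/2\<close>, the
      equality case of the bound on \<open>||x||_A ||y||_A\<close>.\<close>
    define r :: real where "r = 1 / sqrt 2"
    have s: "s > 0" using False nn[of w] by (simp add: s_def w_def)
    have r: "r\<^sup>2 = 1 / 2" by (simp add: r_def power_divide)
    have "(norm_A A ((r / s) *\<^sub>R w))\<^sup>2 = 1 / 2"
      using s r by (simp add: norm_A_scaleR[OF A] s_def[symmetric])
    moreover have "(norm_A A (r *\<^sub>R y))\<^sup>2 = 1 / 2"
      by (simp add: norm_A_scaleR[OF A] y r)
    ultimately have z: "norm_A D ((r / s) *\<^sub>R w, r *\<^sub>R y) = 1"
      by (simp add: D_eq_1)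
    have scale: "T12 (r *\<^sub>R y) = r *\<^sub>R T12 y" "T21 (r *\<^sub>R y) = r *\<^sub>R T21 y"
      using T12 T21 by (simp_all add: has_A_adjoint_def bounded_clinear_scaleR)
    have "Re (inner_A A (T12 y) w) + Re (inner_A A (T21 y) w) = s\<^sup>2"
      by (simp add: s_def power2_norm_A[OF A])
        (simp add: w_def inner_A_add_left[OF A])
    \<comment> \<open>Since \<open>r (r / s) = 1 / (2 s)\<close>, the value \<open>s^2\<close> is
      rescaled to \<open>s / 2\<close>. Passing to real parts next removes the conjugate on the
      \<open>T21\<close> term.\<close>
    then have "s / 2 = r * (r / s) * (Re (inner_A A (T12 y) w) + Re (inner_A A (T21 y) w))"
      using s r by (simp add: power2_eq_square)
    also have "\<dots> = Re (inner_A D (B ((r / s) *\<^sub>R w, r *\<^sub>R y)) ((r / s) *\<^sub>R w, r *\<^sub>R y))"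
      by (simp add: form scale inner_A_scaleR_left[OF A] inner_A_scaleR_right distrib_left mult_ac)
    also have "\<dots> \<le> numradius_A D B"
      using numradius_ge[OF z] complex_Re_le_cmod order_trans by blast
    finally show ?thesis by (simp add: s_def w_def)
  qed
  have "opnorm_A A (\<lambda>x. T12 x + T21 x) \<le> 2 * numradius_A D B"
    unfolding opnorm_A_def using e lower by (intro cSUP_least) auto
  then show ?thesis
    using upper unfolding D_def B_def c_def by simp
qed

end
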